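(* Let $P$ be a partially ordered pattern (a partial order on $\{1,\ldots,k\}$) that is bipartite, i.e. contains no chain of three elements. Then the permutation class $\operatorname{Av}(P)$ has a regular insertion encoding.
   Context: A permutation $\pi$ of size $n$ contains the POP $P$ if there are indices $i_1<i_2<\cdots<i_k$ such that $\pi(i_a)<\pi(i_b)$ whenever $a<_P b$; $\operatorname{Av}(P)$ is the set of all permutations (of all sizes) avoiding $P$. Insertion encoding: a permutation of size $n$ is built by inserting the values $1,2,\ldots,n$ in increasing order into a configuration, a word over the symbols $\bullet$ (placed entry) and $\diamond$ (slot), starting from the single slot $\diamond$. At step $j$ the value $j$ is inserted into the $i$-th slot from the left by one of four operations: $f_i$ replaces that slot by $\bullet$, $l_i$ by $\bullet\diamond$, $r_i$ by $\diamond\bullet$, $m_i$ by $\diamond\bullet\diamond$; after $n$ steps no slots remain and the left-to-right sequence of inserted values is the permutation. Every permutation has a unique such encoding as a word over the letters $\{f_i,l_i,r_i,m_i : i\ge 1\}$. A permutation class has a regular insertion encoding if the set of encodings of its members is a regular language over a finite alphabet. *)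

theory Defs
  imports "HOL-Combinatorics.Multiset_Permutations"
begin

text \<open>
  A pattern of size \<open>k\<close> is a (reflexive) partial order \<open>P\<close> on \<open>{1..k}\<close>. A permutation of size
  \<open>n\<close> is the list of its values, so the entry at position \<open>i\<close> is \<open>\<pi> ! (i - 1)\<close>.
\<close>

definition bipartite_pop :: "nat rel \<Rightarrow> bool" where
  "bipartite_pop P \<longleftrightarrow> \<not> (\<exists>C \<in> Chains P. card C = 3)"

definition contains_pop :: "nat \<Rightarrow> nat rel \<Rightarrow> nat list \<Rightarrow> bool" where
  "contains_pop k P \<pi> \<longleftrightarrow>
     (\<exists>i. strict_mono_on {1..k} i \<and> i ` {1..k} \<subseteq> {1..length \<pi>} \<and>
          (\<forall>a\<in>{1..k}. \<forall>b\<in>{1..k}. (a, b) \<in> P \<and> a \<noteq> b \<longrightarrow> \<pi> ! (i a - 1) < \<pi> ! (i b - 1)))"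

definition Av :: "nat \<Rightarrow> nat rel \<Rightarrow> nat list set" where
  "Av k P = {\<pi>. (\<exists>n. \<pi> \<in> permutations_of_set {1..n}) \<and> \<not> contains_pop k P \<pi>}"

text \<open>
  Every placed entry of a configuration is labelled with its value, so that the permutation can
  be read off a configuration without slots.
\<close>

datatype symbol = Slot | Entry nat

datatype operation = Fill | Leftmost | Rightmost | Middle

text \<open>
  \<open>(Fill, i)\<close>, \<open>(Leftmost, i)\<close>, \<open>(Rightmost, i)\<close>, \<open>(Middle, i)\<close> stand for the letters
  \<open>f\<close>, \<open>l\<close>, \<open>r\<close>, \<open>m\<close> with index \<open>i\<close>.
\<close>

type_synonym letter = "operation \<times> nat"

fun replacement :: "operation \<Rightarrow> nat \<Rightarrow> symbol list" where
  "replacement Fill j = [Entry j]"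
| "replacement Leftmost j = [Entry j, Slot]"
| "replacement Rightmost j = [Slot, Entry j]"
| "replacement Middle j = [Slot, Entry j, Slot]"

definition insertion :: "nat \<Rightarrow> letter \<Rightarrow> symbol list \<Rightarrow> symbol list \<Rightarrow> bool" where
  "insertion j x c c' \<longleftrightarrow>
     (\<exists>us vs. c = us @ Slot # vs \<and> snd x = count_list us Slot + 1 \<and>
              c' = us @ replacement (fst x) j @ vs)"

inductive builds :: "letter list \<Rightarrow> symbol list \<Rightarrow> bool" where
  start: "builds [] [Slot]"
| step: "builds w c \<Longrightarrow> insertion (length w + 1) x c c' \<Longrightarrow> builds (w @ [x]) c'"

text \<open>
  The empty permutation has no encoding, since the initial configuration contains a slot.
\<close>

definition encodes :: "letter list \<Rightarrow> nat list \<Rightarrow> bool" where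
  "encodes w \<pi> \<longleftrightarrow> builds w (map Entry \<pi>)"

definition encodings :: "nat list set \<Rightarrow> letter list set" where
  "encodings C = {w. \<exists>\<pi>\<in>C. encodes w \<pi>}"

text \<open>
  Acceptance by a complete deterministic finite automaton over the alphabet \<open>\<Sigma>\<close>; taking natural
  numbers as states loses no generality.
\<close>

definition regular_language :: "'a set \<Rightarrow> 'a list set \<Rightarrow> bool" where
  "regular_language \<Sigma> L \<longleftrightarrow>
     (\<exists>(Q :: nat set) q0 \<delta> F.
        finite Q \<and> q0 \<in> Q \<and> F \<subseteq> Q \<and> (\<forall>q\<in>Q. \<forall>a\<in>\<Sigma>. \<delta> q a \<in> Q) \<and>
        L = {w \<in> lists \<Sigma>. foldl \<delta> q0 w \<in> F})"

definition has_regular_insertion_encoding :: "nat list set \<Rightarrow> bool" where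
  "has_regular_insertion_encoding C \<longleftrightarrow>
     (\<exists>\<Sigma>. finite \<Sigma> \<and> regular_language \<Sigma> (encodings C))"

end

theory Submission
  imports Defs "HOL-Library.Sublist"
begin

text \<open>
  Two slots are never adjacent, and every slot eventually receives an entry larger than all entries
  already placed. A configuration with more than \<open>k\<close> slots therefore forces an alternation
  large, small, large, small, ... in which every word of length \<open>k\<close> over large and small occurs;
  sending the elements of \<open>P\<close> that have a strict predecessor to large entries and all others to
  small ones embeds \<open>P\<close>, as \<open>P\<close> has no chain of three elements. So only \<open>k\<close> slots occur while
  building a permutation that avoids \<open>P\<close>.

  Since values are inserted in increasing order, the elements of \<open>P\<close> placed so far by an embedding
  form a down-set, and all that matters for completing the embedding is how these elements are
  interleaved with the slots. The set of interleavings that can be realised in a configuration takes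
  finitely many values, and its change under an insertion depends only on the letter: it is the
  state of a deterministic automaton.
\<close>

section \<open>Automata with states of any type\<close>

lemma regular_languageI:
  assumes "finite (Q :: 'q set)" "q0 \<in> Q" "F \<subseteq> Q"
    and closed: "\<And>q a. q \<in> Q \<Longrightarrow> a \<in> \<Sigma> \<Longrightarrow> \<delta> q a \<in> Q"
  shows "regular_language \<Sigma> {w \<in> lists \<Sigma>. foldl \<delta> q0 w \<in> F}"
proof -
  \<comment> \<open>\<open>regular_language\<close> wants numbers as states: \<open>h\<close>
    renames the finite set \<open>Q\<close>, and the new transition decodes a number, moves in
    \<open>Q\<close> and encodes again.\<close>
  obtain h :: "'q \<Rightarrow> nat" where inj: "inj_on h Q"
    using finite_imp_inj_to_nat_seg[OF assms(1)] by blast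
  define \<delta>' where "\<delta>' n a = h (\<delta> (inv_into Q h n) a)" for n a
  have run: "foldl \<delta> q0 w \<in> Q \<and> foldl \<delta>' (h q0) w = h (foldl \<delta> q0 w)" if "w \<in> lists \<Sigma>" for w
    using that
  proof (induction w rule: rev_induct)
    case Nil
    then show ?case using assms(2) by simp
  next
    case (snoc a w)
    then show ?case using closed by (simp add: \<delta>'_def inv_into_f_f[OF inj])
  qed
  have "{w \<in> lists \<Sigma>. foldl \<delta> q0 w \<in> F} = {w \<in> lists \<Sigma>. foldl \<delta>' (h q0) w \<in> h ` F}"
    using run inj_on_image_mem_iff[OF inj _ assms(3)]
    by (intro Collect_cong conj_cong refl) metis
  moreover have "\<delta>' n a \<in> h ` Q" if "n \<in> h ` Q" "a \<in> \<Sigma>" for n a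
    using that closed by (auto simp: \<delta>'_def inv_into_f_f[OF inj])
  ultimately show ?thesis
    unfolding regular_language_def using assms
    by (intro exI[of _ "h ` Q"] exI[of _ "h q0"] exI[of _ \<delta>'] exI[of _ "h ` F"]) auto
qed

section \<open>Subsequences and index maps\<close>

lemma subseq_imp_strict_mono_nth:
  assumes "subseq xs ys"
  shows "\<exists>f. strict_mono_on {..<length xs} f \<and>
             (\<forall>i<length xs. f i < length ys \<and> ys ! f i = xs ! i)"
  using assms
proof (induction rule: list_emb.induct)
  case (list_emb_Nil ys)
  then show ?case by (auto simp: strict_mono_on_def)
next
  case (list_emb_Cons xs ys y)
  then obtain f where "strict_mono_on {..<length xs} f"
    "\<forall>i<length xs. f i < length ys \<and> ys ! f i = xs ! i" by blast
  then show ?case by (intro exI[of _ "\<lambda>i. Suc (f i)"]) (auto simp: strict_mono_on_def)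
next
  case (list_emb_Cons2 x y xs ys)
  then obtain f where "strict_mono_on {..<length xs} f"
    "\<forall>i<length xs. f i < length ys \<and> ys ! f i = xs ! i" by blast
  then show ?case using list_emb_Cons2
    by (intro exI[of _ "case_nat 0 (\<lambda>i. Suc (f i))"])
      (auto simp: strict_mono_on_def nth_Cons split: nat.splits)
qed

text \<open>Each block \<open>[True, False]\<close> offers either letter, so every letter of
  \<open>xs\<close> can use a block of its own.\<close>

lemma subseq_replicate_True_False:
  "length xs = n \<Longrightarrow> subseq xs (concat (replicate n [True, False]))"
proof (induction n arbitrary: xs)
  case (Suc n)
  then obtain x ys where "xs = x # ys" "length ys = n" by (cases xs) auto
  then show ?case using Suc.IH[of ys] by (cases x) auto
qed simp

section \<open>Entries and slots of configurations\<close>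

fun entries :: "symbol list \<Rightarrow> nat list" where
  "entries [] = []"
| "entries (Slot # c) = entries c"
| "entries (Entry v # c) = v # entries c"

lemma entries_append [simp]: "entries (c @ d) = entries c @ entries d"
  by (induction c rule: entries.induct) auto

lemma entries_map_Entry [simp]: "entries (map Entry \<pi>) = \<pi>"
  by (induction \<pi>) auto

lemma set_entries: "v \<in> set (entries c) \<longleftrightarrow> Entry v \<in> set c"
  by (induction c rule: entries.induct) auto

lemma map_Entry_entries: "Slot \<notin> set c \<Longrightarrow> map Entry (entries c) = c"
  by (induction c rule: entries.induct) auto

lemma entries_replacement [simp]: "entries (replacement op j) = [j]"
  by (cases op) auto

lemma length_eq_count_Slot_entries: "length c = count_list c Slot + length (entries c)"
  by (induction c rule: entries.induct) auto

text \<open>The index of a letter fixes the number of slots to the left, hence the slot itself. This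
  makes insertion deterministic, in configurations and in their projections alike.\<close>

lemma split_at_Slot_unique:
  assumes "us @ Slot # vs = us' @ Slot # vs'" "count_list us Slot = count_list us' Slot"
  shows "us = us' \<and> vs = vs'"
  using assms
proof (induction us arbitrary: us')
  case Nil
  then show ?case by (cases us') auto
next
  case (Cons s us)
  then show ?case by (cases us') (auto split: if_splits)
qed

section \<open>Projection of configurations to pattern elements\<close>

text \<open>
  The map \<open>g\<close> assigns elements of the pattern to values; in a projected configuration \<open>Entry a\<close>
  stands for the element \<open>a\<close> of the pattern instead of a value.
\<close>

fun project :: "(nat \<rightharpoonup> nat) \<Rightarrow> symbol list \<Rightarrow> symbol list" where
  "project g [] = []"
| "project g (Slot # c) = Slot # project g c"
| "project g (Entry v # c) =
     (case g v of None \<Rightarrow> project g c | Some a \<Rightarrow> Entry a # project g c)"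

lemma project_append [simp]: "project g (c @ d) = project g c @ project g d"
  by (induction g c rule: project.induct) (auto split: option.splits)

lemma count_Slot_project [simp]: "count_list (project g c) Slot = count_list c Slot"
  by (induction g c rule: project.induct) (auto split: option.splits)

lemma project_cong:
  "(\<And>v. Entry v \<in> set c \<Longrightarrow> g v = g' v) \<Longrightarrow> project g c = project g' c"
  by (induction g c rule: project.induct) (auto split: option.splits)

lemma Entry_in_project: "Entry a \<in> set (project g c) \<longleftrightarrow> (\<exists>v. Entry v \<in> set c \<and> g v = Some a)"
  by (induction g c rule: project.induct) (auto split: option.splits)

lemma project_empty: "project Map.empty c = replicate (count_list c Slot) Slot"
  by (induction "Map.empty :: nat \<rightharpoonup> nat" c rule: project.induct) auto

text \<open>The 0 is a dummy: the filter removes the entry and leaves only the slots created by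
  \<open>op\<close>.\<close>

lemma project_replacement_None:
  "g j = None \<Longrightarrow> project g (replacement op j) = filter (\<lambda>s. s = Slot) (replacement op 0)"
  by (cases op) auto

lemma project_replacement_Some:
  "g j = Some b \<Longrightarrow> project g (replacement op j) = replacement op b"
  by (cases op) auto

text \<open>Projection keeps every slot, so a slot picked in the projection lifts to one of
  \<open>c\<close>.\<close>

lemma project_split:
  assumes "project g c = us @ Slot # vs"
  shows "\<exists>us' vs'. c = us' @ Slot # vs' \<and> project g us' = us \<and> project g vs' = vs"
  using assms
proof (induction g c arbitrary: us rule: project.induct)
  case (2 g c)
  show ?case
  proof (cases us)
    case Nil
    then show ?thesis using 2 by (intro exI[of _ "[]"] exI[of _ c]) auto
  next
    case (Cons s us1)
    then obtain us' vs' where "c = us' @ Slot # vs'" "project g us' = us1" "project g vs' = vs"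
      using 2 by auto
    then show ?thesis using 2 Cons by (intro exI[of _ "Slot # us'"] exI[of _ vs']) auto
  qed
next
  case (3 g v c)
  show ?case
  proof (cases "g v")
    case None
    then obtain us' vs' where "c = us' @ Slot # vs'" "project g us' = us" "project g vs' = vs"
      using 3 by auto
    then show ?thesis using None by (intro exI[of _ "Entry v # us'"] exI[of _ vs']) auto
  next
    case (Some a)
    with 3 obtain us1 where us1: "us = Entry a # us1" by (cases us) auto
    then obtain us' vs' where "c = us' @ Slot # vs'" "project g us' = us1" "project g vs' = vs"
      using 3(2)[of a us1] 3(3) Some by auto
    then show ?thesis using Some us1 by (intro exI[of _ "Entry v # us'"] exI[of _ vs']) auto
  qed
qed auto

section \<open>Reachable configurations and the bound on their slots\<close>

lemma builds_entries: "builds w c \<Longrightarrow> distinct (entries c) \<and> set (entries c) = {1..length w}"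
proof (induction rule: builds.induct)
  case start
  then show ?case by simp
next
  case (step w c x c')
  then obtain us vs where "c = us @ Slot # vs" "c' = us @ replacement (fst x) (length w + 1) @ vs"
    by (auto simp: insertion_def)
  moreover have "Suc (length w) \<notin> set (entries c)" using step.IH by simp
  ultimately have "distinct (entries c')"
    "set (entries c') = insert (Suc (length w)) {1..length w}" using step.IH by auto
  then show ?case by (simp add: atLeastAtMostSuc_conv)
qed

lemma builds_snocE:
  assumes "builds (w @ [x]) c'"
  obtains c where "builds w c" "insertion (length w + 1) x c c'"
  using assms by (cases rule: builds.cases) auto

text \<open>The neighbours of a slot are entries, and the slots that an insertion leaves are
  separated by the new entry.\<close>

lemma builds_successively:
  "builds w c \<Longrightarrow> successively (\<lambda>s t. \<not> (s = Slot \<and> t = Slot)) c"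
proof (induction rule: builds.induct)
  case start
  then show ?case by simp
next
  case (step w c x c')
  then obtain us vs where "c = us @ Slot # vs" "c' = us @ replacement (fst x) (length w + 1) @ vs"
    by (auto simp: insertion_def)
  with step.IH show ?case
    by (cases "fst x") (auto simp: successively_append_iff successively_Cons)
qed

text \<open>Every slot but the last is followed by an entry before the next slot; hence the strict
  bound on \<open>n\<close>.\<close>

lemma subseq_alternating_Slots:
  assumes "successively (\<lambda>s t. \<not> (s = Slot \<and> t = Slot)) c" "n < count_list c Slot"
  shows "subseq (concat (replicate n [True, False])) (map (\<lambda>s. s = Slot) c)"
  using assms
proof (induction c arbitrary: n rule: induct_list012)
  case (2 s)
  then show ?case by (cases n) (auto split: if_splits)
next
  case (3 s t c)
  show ?case
  proof (cases "s = Slot \<and> n \<noteq> 0")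
    case True
    then obtain m where "n = Suc m" by (cases n) auto
    with True 3 show ?thesis by (cases c) (auto simp: successively_Cons)
  next
    case False
    then show ?thesis using 3 by (cases "n = 0") auto
  qed
qed auto

text \<open>With \<open>j\<close> the last value inserted, a slot counts as large because any entry
  it receives later is larger than \<open>j\<close>.\<close>

definition exceeds :: "nat \<Rightarrow> symbol \<Rightarrow> bool" where
  "exceeds j s \<longleftrightarrow> (case s of Slot \<Rightarrow> True | Entry v \<Rightarrow> j < v)"

lemma builds_unique: "builds w c \<Longrightarrow> builds w d \<Longrightarrow> c = d"
proof (induction arbitrary: d rule: builds.induct)
  case start
  then show ?case by (auto elim: builds.cases)
next
  case (step w c x c')
  from step.prems obtain e where "builds w e" "insertion (length w + 1) x e d"
    by (rule builds_snocE)
  with step.IH have "insertion (length w + 1) x c d" by blast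
  then obtain us vs where 1: "c = us @ Slot # vs" "snd x = count_list us Slot + 1"
    "d = us @ replacement (fst x) (length w + 1) @ vs" by (auto simp: insertion_def)
  from step.hyps(2) obtain us' vs' where 2: "c = us' @ Slot # vs'" "snd x = count_list us' Slot + 1"
    "c' = us' @ replacement (fst x) (length w + 1) @ vs'" by (auto simp: insertion_def)
  from 1 2 show ?case using split_at_Slot_unique[of us vs us' vs'] by simp
qed

text \<open>Whatever is later put into a slot contains a larger entry.\<close>

lemma builds_subseq_exceeds:
  assumes "builds w c" "builds (w @ u) d"
  shows "subseq (map (exceeds (length w)) c) (map (exceeds (length w)) d)"
  using assms(2)
proof (induction u arbitrary: d rule: rev_induct)
  case Nil
  then show ?case using builds_unique[OF assms(1)] by auto
next
  case (snoc x u)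
  then have "builds ((w @ u) @ [x]) d" by simp
  then obtain e where e: "builds (w @ u) e" "insertion (length (w @ u) + 1) x e d"
    by (rule builds_snocE)
  from e(2) obtain us vs where
    "e = us @ Slot # vs" "d = us @ replacement (fst x) (length (w @ u) + 1) @ vs"
    by (auto simp: insertion_def)
  \<comment> \<open>The new value is larger than \<open>length w\<close>, so the replacement
    contains a \<open>True\<close> to match that of the slot it replaces.\<close>
  then have "subseq (map (exceeds (length w)) e) (map (exceeds (length w)) d)"
    by (cases "fst x") (auto simp: exceeds_def intro!: list_emb_append_mono)
  with snoc.IH[OF e(1)] show ?case
    by (meson subseq_order.order_trans)
qed

text \<open>Antisymmetry separates \<open>a\<close> from \<open>c\<close> and transitivity makes
  them comparable, so two strict steps yield a chain of three elements.\<close>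

lemma bipartite_pop_no_path:
  assumes "partial_order_on A P" "bipartite_pop P"
    and "(a, b) \<in> P" "(b, c) \<in> P" "a \<noteq> b" "b \<noteq> c"
  shows False
proof -
  have po: "refl_on A P" "trans P" "antisym P" "P \<subseteq> A \<times> A"
    using assms(1) by (auto simp: order_on_defs)
  have "a \<noteq> c" using assms po(3) by (auto dest: antisymD)
  then have "card {a, b, c} = 3" using assms by simp
  moreover have "{a, b, c} \<in> Chains P"
    using assms(3,4) po by (auto simp: Chains_def refl_on_def dest: transD)
  ultimately show False using assms(2) unfolding bipartite_pop_def by blast
qed

lemma count_Slot_le_if_avoids:
  assumes "partial_order_on {1..k} P" "bipartite_pop P"
    and w: "builds w c" "builds (w @ u) (map Entry \<pi>)" and "\<not> contains_pop k P \<pi>"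
  shows "count_list c Slot \<le> k"
proof (rule ccontr)
  let ?j = "length w"
  define big where "big b \<longleftrightarrow> (\<exists>a. (a, b) \<in> P \<and> a \<noteq> b)" for b
  let ?xs = "map big [1..<Suc k]"
  assume "\<not> count_list c Slot \<le> k"
  then have "subseq (concat (replicate k [True, False])) (map (\<lambda>s. s = Slot) c)"
    by (intro subseq_alternating_Slots builds_successively[OF w(1)]) simp
  \<comment> \<open>All values placed so far are at most \<open>?j\<close>, so exactly the slots
    exceed it.\<close>
  also have "map (\<lambda>s. s = Slot) c = map (exceeds ?j) c"
    using builds_entries[OF w(1)]
    by (auto simp: exceeds_def set_entries[symmetric] split: symbol.split)
  also have "subseq \<dots> (map (exceeds ?j) (map Entry \<pi>))"
    by (rule builds_subseq_exceeds[OF w])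
  finally have "subseq ?xs (map (exceeds ?j) (map Entry \<pi>))"
    using subseq_replicate_True_False[of ?xs k] by (auto intro: subseq_order.order_trans)
  from subseq_imp_strict_mono_nth[OF this] obtain f where
    f: "strict_mono_on {..<k} f" and
    nth': "\<forall>i<k. f i < length \<pi> \<and> map (exceeds ?j \<circ> Entry) \<pi> ! f i = big (Suc i)"
    by (auto simp del: upt_Suc)
  have nth: "f i < length \<pi> \<and> (?j < \<pi> ! f i \<longleftrightarrow> big (Suc i))" if "i < k" for i
    using nth' that by (auto simp: exceeds_def)
  define i where "i a = Suc (f (a - 1))" for a
  have val: "?j < \<pi> ! (i a - 1) \<longleftrightarrow> big a" "i a \<in> {1..length \<pi>}" if "a \<in> {1..k}" for a
    using nth[of "a - 1"] that by (auto simp: i_def Suc_le_eq)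
  have "\<pi> ! (i a - 1) < \<pi> ! (i b - 1)"
    if "a \<in> {1..k}" "b \<in> {1..k}" "(a, b) \<in> P" "a \<noteq> b" for a b
  proof -
    \<comment> \<open>If \<open>a\<close> had a strict predecessor, it would form a chain of three
      with \<open>a\<close> and \<open>b\<close>. So \<open>a\<close> goes to a value at most
      \<open>?j\<close> and \<open>b\<close> to one above.\<close>
    have "big b" "\<not> big a"
      using that bipartite_pop_no_path[OF assms(1,2)] by (auto simp: big_def)
    then show ?thesis using val(1)[of a] val(1)[of b] that by linarith
  qed
  moreover have "strict_mono_on {1..k} i"
    using f unfolding strict_mono_on_def i_def
    by (auto simp: less_diff_conv2 intro!: diff_less_mono)
  ultimately have "contains_pop k P \<pi>"
    unfolding contains_pop_def using val(2) by blast
  with assms(5) show False by simp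
qed

section \<open>Shapes, partial embeddings and transitions\<close>

text \<open>Embeddings increase in position, so the placed elements ascend from left to right. The
  bound \<open>Suc k\<close>, rather than \<open>k\<close>, admits the start \<open>[Slot]\<close>
  even for \<open>k = 0\<close>.\<close>

definition shapes :: "nat \<Rightarrow> symbol list set" where
  "shapes k = {t. sorted_wrt (<) (entries t) \<and> set (entries t) \<subseteq> {1..k} \<and>
     count_list t Slot \<le> Suc k}"

lemma finite_shapes: "finite (shapes k)"
proof (rule finite_subset)
  show "shapes k \<subseteq> {t. set t \<subseteq> insert Slot (Entry ` {1..k}) \<and> length t \<le> Suc k + k}"
  proof
    fix t assume t: "t \<in> shapes k"
    then have "distinct (entries t)" by (simp add: shapes_def strict_sorted_iff)
    then have "length (entries t) \<le> k"
      using t card_mono[of "{1..k}" "set (entries t)"] by (simp add: shapes_def distinct_card)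
    then have "length t \<le> Suc k + k"
      using t length_eq_count_Slot_entries[of t] by (simp add: shapes_def)
    moreover have "s \<in> insert Slot (Entry ` {1..k})" if "s \<in> set t" for s
    proof (cases s)
      case (Entry v)
      with that have "v \<in> set (entries t)" by (simp add: set_entries)
      with t Entry show ?thesis by (auto simp: shapes_def)
    qed simp
    ultimately show "t \<in> {t. set t \<subseteq> insert Slot (Entry ` {1..k}) \<and> length t \<le> Suc k + k}"
      by auto
  qed
qed (auto intro: finite_lists_length_le)

text \<open>
  Beside closure under predecessors, this says that \<open>g\<close> respects the order: the predecessors of a
  placed element sit at smaller values.
\<close>

definition down_closed :: "nat rel \<Rightarrow> (nat \<rightharpoonup> nat) \<Rightarrow> bool" where
  "down_closed P g \<longleftrightarrow>
     (\<forall>u a b. g u = Some b \<and> (a, b) \<in> P \<and> a \<noteq> b \<longrightarrow> (\<exists>v<u. g v = Some a))"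

text \<open>An embedding is stored inversely, from values to elements. Its injectivity and its
  monotonicity in position are enforced by \<open>shapes k\<close>, values by
  \<open>down_closed\<close>.\<close>

definition partial_embeddings :: "nat \<Rightarrow> nat rel \<Rightarrow> nat \<Rightarrow> symbol list \<Rightarrow> symbol list set" where
  "partial_embeddings k P j c =
     {project g c | g. dom g \<subseteq> {1..j} \<and> down_closed P g \<and> project g c \<in> shapes k}"

text \<open>
  The two alternatives for \<open>ys\<close>: the new value is not used by the embedding, or it plays \<open>b\<close>.
\<close>

definition extends :: "nat rel \<Rightarrow> letter \<Rightarrow> symbol list \<Rightarrow> symbol list \<Rightarrow> bool" where
  "extends P x t t' \<longleftrightarrow>
     (\<exists>us vs ys. t = us @ Slot # vs \<and> snd x = count_list us Slot + 1 \<and> t' = us @ ys @ vs \<and>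
        (ys = filter (\<lambda>s. s = Slot) (replacement (fst x) 0) \<or>
         (\<exists>b. ys = replacement (fst x) b \<and> (\<forall>a. (a, b) \<in> P \<and> a \<noteq> b \<longrightarrow> Entry a \<in> set t))))"

text \<open>Intersecting with \<open>shapes k\<close> rejects a new element that is out of order,
  repeated or outside the pattern, and any result with too many slots.\<close>

definition advance :: "nat \<Rightarrow> nat rel \<Rightarrow> symbol list set \<Rightarrow> letter \<Rightarrow> symbol list set" where
  "advance k P S x = {t' \<in> shapes k. \<exists>t\<in>S. extends P x t t'}"

text \<open>As \<open>Suc j\<close> is the largest value so far, a labelling of
  \<open>{1..Suc j}\<close> is one of \<open>{1..j}\<close> plus a role for \<open>Suc j\<close>.
  Whether the predecessors of that role are already placed can be read off the projection.\<close>

lemma advance_partial_embeddings: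
  assumes c: "set (entries c) = {1..j}" and slots: "count_list c Slot \<le> Suc k"
    and ins: "insertion (Suc j) x c c'"
  shows "advance k P (partial_embeddings k P j c) x = partial_embeddings k P (Suc j) c'"
proof -
  from ins obtain us vs where split: "c = us @ Slot # vs" "snd x = count_list us Slot + 1"
    "c' = us @ replacement (fst x) (Suc j) @ vs" by (auto simp: insertion_def)
  have le: "v \<le> j \<and> 1 \<le> v" if "Entry v \<in> set us \<or> Entry v \<in> set vs" for v
    using that c set_entries[of v c] split(1) by auto
  have same: "project (g(Suc j := y)) us = project g us" "project (g(Suc j := y)) vs = project g vs"
    for g y using le[of "Suc j"] by (auto intro!: project_cong)
  show ?thesis
  proof (intro equalityI subsetI)
    fix t' assume "t' \<in> advance k P (partial_embeddings k P j c) x"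
    then obtain g where t': "t' \<in> shapes k" and g: "dom g \<subseteq> {1..j}" "down_closed P g"
      and "extends P x (project g c) t'"
      by (auto simp: advance_def partial_embeddings_def)
    then obtain us1 vs1 ys where e: "project g c = us1 @ Slot # vs1"
      "snd x = count_list us1 Slot + 1" "t' = us1 @ ys @ vs1"
      and ys: "ys = filter (\<lambda>s. s = Slot) (replacement (fst x) 0) \<or>
         (\<exists>b. ys = replacement (fst x) b \<and>
            (\<forall>a. (a, b) \<in> P \<and> a \<noteq> b \<longrightarrow> Entry a \<in> set (project g c)))"
      unfolding extends_def by blast
    have "project g us @ Slot # project g vs = us1 @ Slot # vs1"
      using e(1) split(1) by simp
    \<comment> \<open>Both splits are at the slot with index \<open>snd x\<close>, so the one from
      \<open>extends\<close> is the projection of the one from \<open>insertion\<close>.\<close>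
    then have eq: "us1 = project g us" "vs1 = project g vs"
      using split_at_Slot_unique[of "project g us" "project g vs" us1 vs1] e(2) split(2) by auto
    have None: "g (Suc j) = None" using g(1) by (auto simp: domIff subset_iff)
    \<comment> \<open>\<open>y\<close> is the role of the new value: \<open>None\<close> if the
      embedding skips it, \<open>Some b\<close> if it plays \<open>b\<close>.\<close>
    obtain y where y: "project (g(Suc j := y)) (replacement (fst x) (Suc j)) = ys"
      and y_pred: "\<And>a b. y = Some b \<Longrightarrow> (a, b) \<in> P \<Longrightarrow> a \<noteq> b \<Longrightarrow> Entry a \<in> set (project g c)"
      using ys
    proof
      assume "ys = filter (\<lambda>s. s = Slot) (replacement (fst x) 0)"
      then show thesis using that[of None] by (simp add: project_replacement_None)
    next
      assume "\<exists>b. ys = replacement (fst x) b \<and>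
            (\<forall>a. (a, b) \<in> P \<and> a \<noteq> b \<longrightarrow> Entry a \<in> set (project g c))"
      then obtain b where "ys = replacement (fst x) b"
        "\<forall>a. (a, b) \<in> P \<and> a \<noteq> b \<longrightarrow> Entry a \<in> set (project g c)" by blast
      then show thesis using that[of "Some b"] by (simp add: project_replacement_Some)
    qed
    let ?g = "g(Suc j := y)"
    have "t' = project ?g c'"
      using e(3) eq y split(3) same by simp
    moreover have "dom ?g \<subseteq> {1..Suc j}" using g(1) by (fastforce split: if_splits)
    moreover have "down_closed P ?g"
      unfolding down_closed_def
    proof (intro allI impI)
      fix u a b assume A: "?g u = Some b \<and> (a, b) \<in> P \<and> a \<noteq> b"
      show "\<exists>v<u. ?g v = Some a"
      proof (cases "u = Suc j")
        case True
        then have "Entry a \<in> set (project g c)" using A y_pred by auto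
        then obtain v where "Entry v \<in> set c" "g v = Some a" by (auto simp: Entry_in_project)
        then show ?thesis using True c set_entries[of v c] by (intro exI[of _ v]) auto
      next
        case False
        then obtain v where "v < u" "g v = Some a"
          using A g(2) unfolding down_closed_def by fastforce
        then show ?thesis using None by (intro exI[of _ v]) auto
      qed
    qed
    ultimately show "t' \<in> partial_embeddings k P (Suc j) c'"
      using t' unfolding partial_embeddings_def by blast
  next
    fix t' assume "t' \<in> partial_embeddings k P (Suc j) c'"
    then obtain h where h: "t' = project h c'" "dom h \<subseteq> {1..Suc j}" "down_closed P h"
      and t': "t' \<in> shapes k" by (auto simp: partial_embeddings_def)
    let ?g = "h(Suc j := None)"
    let ?ys = "project h (replacement (fst x) (Suc j))"
    have t'_eq: "t' = project ?g us @ ?ys @ project ?g vs"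
      using h(1) split(3) same[of h None] by simp
    have gc: "project ?g c = project ?g us @ Slot # project ?g vs"
      using split(1) by simp
    have dom: "dom ?g \<subseteq> {1..j}"
    proof
      fix v assume "v \<in> dom ?g"
      then have "v \<in> dom h" "v \<noteq> Suc j" by (auto split: if_splits)
      with h(2) have "v \<in> {1..Suc j}" by blast
      with \<open>v \<noteq> Suc j\<close> show "v \<in> {1..j}" by auto
    qed
    \<comment> \<open>Predecessors sit at smaller values, so forgetting the largest value loses none
      that is still required.\<close>
    have "down_closed P ?g"
      unfolding down_closed_def
    proof (intro allI impI)
      fix u a b assume A: "?g u = Some b \<and> (a, b) \<in> P \<and> a \<noteq> b"
      then have "u \<le> j" using dom by (auto simp: subset_iff dom_def split: if_splits)
      moreover obtain v where "v < u" "h v = Some a"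
        using A h(3) unfolding down_closed_def by (fastforce split: if_splits)
      ultimately show "\<exists>v<u. ?g v = Some a" by (intro exI[of _ v]) auto
    qed
    \<comment> \<open>Dropping the new element keeps the entries ascending. The slot bound is taken
      from \<open>slots\<close>, not from \<open>t'\<close>, since a \<open>Fill\<close> lowers the
      number of slots.\<close>
    moreover have "project ?g c \<in> shapes k"
    proof -
      have "sorted_wrt (<) (entries (project ?g c))" "set (entries (project ?g c)) \<subseteq> {1..k}"
        using t' unfolding shapes_def t'_eq gc by (auto simp: sorted_wrt_append)
      then show ?thesis using slots by (simp add: shapes_def)
    qed
    moreover have "extends P x (project ?g c) t'"
      unfolding extends_def
    proof (intro exI conjI)
      show "project ?g c = project ?g us @ Slot # project ?g vs" by (rule gc)
      show "snd x = count_list (project ?g us) Slot + 1" using split(2) by simp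
      show "t' = project ?g us @ ?ys @ project ?g vs" by (rule t'_eq)
      show "?ys = filter (\<lambda>s. s = Slot) (replacement (fst x) 0) \<or>
         (\<exists>b. ?ys = replacement (fst x) b \<and>
            (\<forall>a. (a, b) \<in> P \<and> a \<noteq> b \<longrightarrow> Entry a \<in> set (project ?g c)))"
      proof (cases "h (Suc j)")
        case None
        then show ?thesis by (simp add: project_replacement_None)
      next
        case (Some b)
        have "Entry a \<in> set (project ?g c)" if ab: "(a, b) \<in> P" "a \<noteq> b" for a
        proof -
          obtain v where v: "v < Suc j" "h v = Some a"
            using ab Some h(3) unfolding down_closed_def by blast
          then have "v \<in> {1..j}" using h(2) by (auto simp: subset_iff dom_def)
          then have "Entry v \<in> set c" using c set_entries[of v c] by auto
          moreover have "?g v = Some a" using v by simp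
          ultimately show ?thesis unfolding Entry_in_project by blast
        qed
        then show ?thesis using project_replacement_Some[of h, OF Some] by blast
      qed
    qed
    moreover from calculation dom have "project ?g c \<in> partial_embeddings k P j c"
      unfolding partial_embeddings_def by blast
    ultimately show "t' \<in> advance k P (partial_embeddings k P j c) x"
      unfolding advance_def using t' by blast
  qed
qed

section \<open>Runs of the automaton\<close>

lemma extends_project_imp_insertion:
  assumes "extends P x (project g c) t'"
  shows "\<exists>c'. insertion j x c c'"
proof -
  from assms obtain us vs where "project g c = us @ Slot # vs" "snd x = count_list us Slot + 1"
    by (auto simp: extends_def)
  with project_split[of g c us vs] show ?thesis by (fastforce simp: insertion_def)
qed

lemma advance_empty [simp]: "advance k P {} x = {}"
  by (simp add: advance_def)

lemma partial_embeddings_start: "partial_embeddings k P 0 [Slot] = {[Slot]}"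
  by (auto simp: partial_embeddings_def shapes_def down_closed_def)

lemma partial_embeddings_slots:
  "t \<in> partial_embeddings k P j c \<Longrightarrow>
   count_list c Slot = count_list t Slot \<and> count_list t Slot \<le> Suc k"
  by (auto simp: partial_embeddings_def shapes_def)

text \<open>The empty state is absorbing, so all states on the way are nonempty. A member that can
  be extended shows that the next letter is applicable and that the slots obey the bound.\<close>

lemma run_nonempty_imp_builds:
  assumes "foldl (advance k P) {[Slot]} w \<noteq> {}"
  shows "\<exists>c. builds w c \<and> foldl (advance k P) {[Slot]} w = partial_embeddings k P (length w) c"
  using assms
proof (induction w rule: rev_induct)
  case Nil
  then show ?case using builds.start by (auto simp: partial_embeddings_start)
next
  case (snoc x w)
  then have "foldl (advance k P) {[Slot]} w \<noteq> {}" by auto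
  with snoc.IH obtain c where c: "builds w c"
    "foldl (advance k P) {[Slot]} w = partial_embeddings k P (length w) c" by blast
  with snoc.prems obtain t t' where t: "t \<in> partial_embeddings k P (length w) c" "extends P x t t'"
    unfolding foldl_append foldl_Cons foldl_Nil advance_def[of k P "foldl _ _ _"] by blast
  then obtain g where "extends P x (project g c) t'" by (auto simp: partial_embeddings_def)
  then obtain c' where c': "insertion (Suc (length w)) x c c'"
    using extends_project_imp_insertion by blast
  have "advance k P (partial_embeddings k P (length w) c) x = partial_embeddings k P (Suc (length w)) c'"
    using advance_partial_embeddings[OF _ _ c'] builds_entries[OF c(1)]
      partial_embeddings_slots[OF t(1)] by auto
  moreover have "builds (w @ [x]) c'" using builds.step[OF c(1)] c' by simp
  ultimately show ?case using c(2) by (intro exI[of _ c']) simp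
qed

text \<open>The index of a letter is at most the number of slots present. Bounding the slots at
  every prefix thus confines the letters to a finite alphabet and lets
  \<open>advance_partial_embeddings\<close> apply at each step.\<close>

lemma builds_imp_run:
  assumes "builds w c" "\<And>u v d. w = u @ v \<Longrightarrow> builds u d \<Longrightarrow> count_list d Slot \<le> Suc k"
  shows "foldl (advance k P) {[Slot]} w = partial_embeddings k P (length w) c
         \<and> w \<in> lists (UNIV \<times> {1..Suc k})"
  using assms
proof (induction rule: builds.induct)
  case start
  then show ?case by (simp add: partial_embeddings_start)
next
  case (step w c x c')
  have slots: "count_list c Slot \<le> Suc k" using step.prems[of w "[x]" c] step.hyps by simp
  have "foldl (advance k P) {[Slot]} w = partial_embeddings k P (length w) c
         \<and> w \<in> lists (UNIV \<times> {1..Suc k})"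
    using step.prems by (intro step.IH) auto
  moreover have "advance k P (partial_embeddings k P (length w) c) x
      = partial_embeddings k P (Suc (length w)) c'"
    using advance_partial_embeddings[OF _ slots] builds_entries[OF step.hyps(1)] step.hyps(2) by simp
  moreover have "x \<in> UNIV \<times> {1..Suc k}"
    using step.hyps(2) slots by (cases x) (auto simp: insertion_def)
  ultimately show ?case by simp
qed

section \<open>Complete embeddings and pattern containment\<close>

lemma project_map_Entry:
  "project g (map Entry \<pi>) = map Entry (map (the \<circ> g) (filter (\<lambda>v. g v \<noteq> None) \<pi>))"
  by (induction \<pi>) (auto split: option.splits)

lemma sorted_wrt_map_filter_iff:
  "sorted_wrt R (map (the \<circ> g) (filter (\<lambda>v. g v \<noteq> None) xs)) \<longleftrightarrow>
   sorted_wrt (\<lambda>u v. \<forall>a b. g u = Some a \<longrightarrow> g v = Some b \<longrightarrow> R a b) xs"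
  by (induction xs) auto

text \<open>A labelling inverts the map from elements to their values: ascending labels mean
  increasing positions, and \<open>down_closed\<close> means that values increase along
  \<open>P\<close>.\<close>

lemma full_embedding_iff_contains_pop:
  assumes po: "partial_order_on {1..k} P" and \<pi>: "distinct \<pi>" "set \<pi> = {1..n}"
  shows "map Entry [1..<Suc k] \<in> partial_embeddings k P n (map Entry \<pi>) \<longleftrightarrow> contains_pop k P \<pi>"
proof
  assume "map Entry [1..<Suc k] \<in> partial_embeddings k P n (map Entry \<pi>)"
  then obtain g where g: "dom g \<subseteq> {1..n}" "down_closed P g"
    and "map Entry [1..<Suc k] = project g (map Entry \<pi>)"
    by (auto simp: partial_embeddings_def simp del: upt_Suc)
  then have eq: "map (the \<circ> g) (filter (\<lambda>v. g v \<noteq> None) \<pi>) = [1..<Suc k]"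
    unfolding project_map_Entry by (metis entries_map_Entry)
  have "sorted_wrt (<) (map (the \<circ> g) (filter (\<lambda>v. g v \<noteq> None) \<pi>))"
    unfolding eq by (simp del: upt_Suc)
  note this[unfolded sorted_wrt_map_filter_iff]
  then have sorted: "a < b"
    if "p < q" "q < length \<pi>" "g (\<pi> ! p) = Some a" "g (\<pi> ! q) = Some b" for p q a b
    using that unfolding sorted_wrt_iff_nth_less by blast
  have inj: "v = u" if "g v = Some a" "g u = Some a" for u v a
  proof -
    have "v \<in> set \<pi>" "u \<in> set \<pi>" using that g(1) \<pi>(2) by blast+
    then obtain p q where "p < length \<pi>" "v = \<pi> ! p" "q < length \<pi>" "u = \<pi> ! q"
      by (auto simp: in_set_conv_nth)
    then show ?thesis
      using sorted[of p q a a] sorted[of q p a a] that by (cases p q rule: linorder_cases) simp_all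
  qed
  have "\<exists>p<length \<pi>. g (\<pi> ! p) = Some a" if "a \<in> {1..k}" for a
  proof -
    have "a \<in> set (map (the \<circ> g) (filter (\<lambda>v. g v \<noteq> None) \<pi>))" unfolding eq using that by auto
    then show ?thesis by (auto simp: in_set_conv_nth)
  qed
  then obtain f where f: "\<And>a. a \<in> {1..k} \<Longrightarrow> f a < length \<pi> \<and> g (\<pi> ! f a) = Some a" by metis
  have "f a < f b" if "a \<in> {1..k}" "b \<in> {1..k}" "a < b" for a b
    using f[OF that(1)] f[OF that(2)] sorted[of "f b" "f a" b a] that(3)
    by (cases "f a" "f b" rule: linorder_cases) auto
  \<comment> \<open>\<open>down_closed\<close> gives some smaller value that plays \<open>a\<close>;
    by \<open>inj\<close> it is \<open>\<pi> ! f a\<close>.\<close>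
  moreover have "\<pi> ! f a < \<pi> ! f b"
    if "a \<in> {1..k}" "b \<in> {1..k}" "(a, b) \<in> P" "a \<noteq> b" for a b
    using f[OF that(1)] f[OF that(2)] g(2) that inj unfolding down_closed_def by metis
  ultimately show "contains_pop k P \<pi>"
    unfolding contains_pop_def using f
    by (intro exI[of _ "\<lambda>a. Suc (f a)"]) (auto simp: strict_mono_on_def Suc_le_eq)
next
  assume "contains_pop k P \<pi>"
  then obtain i where i: "strict_mono_on {1..k} i" "i ` {1..k} \<subseteq> {1..length \<pi>}"
    and less: "\<And>a b. a \<in> {1..k} \<Longrightarrow> b \<in> {1..k} \<Longrightarrow> (a, b) \<in> P \<Longrightarrow> a \<noteq> b \<Longrightarrow>
      \<pi> ! (i a - 1) < \<pi> ! (i b - 1)"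
    unfolding contains_pop_def by blast
  define f where "f a = i a - 1" for a
  have len: "f a < length \<pi>" if "a \<in> {1..k}" for a
    using i(2) that by (fastforce simp: f_def)
  have mono: "f a < f b" if "a \<in> {1..k}" "b \<in> {1..k}" "a < b" for a b
  proof -
    have "i a \<in> {1..length \<pi>}" using i(2) that(1) by blast
    moreover have "i a < i b" using i(1) that by (auto simp: strict_mono_on_def)
    ultimately show ?thesis by (auto simp: f_def)
  qed
  \<comment> \<open>\<open>g\<close> inverts the map from \<open>a\<close> to
    \<open>\<pi> ! f a\<close>; the description is well-defined by \<open>f_inj\<close>
    below.\<close>
  define g where
    "g v = (if \<exists>a\<in>{1..k}. \<pi> ! f a = v then Some (THE a. a \<in> {1..k} \<and> \<pi> ! f a = v) else None)" for v
  have f_inj: "a = b" if "a \<in> {1..k}" "b \<in> {1..k}" "\<pi> ! f a = \<pi> ! f b" for a b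
    using nth_eq_iff_index_eq[OF \<pi>(1) len[OF that(1)] len[OF that(2)]] that(3)
      mono[OF that(1,2)] mono[OF that(2,1)] by (cases a b rule: linorder_cases) auto
  have g_iff: "g v = Some a \<longleftrightarrow> a \<in> {1..k} \<and> \<pi> ! f a = v" for v a
  proof -
    have "(THE a. a \<in> {1..k} \<and> \<pi> ! f a = v) = b" if "b \<in> {1..k}" "\<pi> ! f b = v" for b
      using that f_inj by (intro the_equality) blast+
    then show ?thesis unfolding g_def by auto
  qed
  let ?ls = "map (the \<circ> g) (filter (\<lambda>v. g v \<noteq> None) \<pi>)"
  have "sorted_wrt (<) ?ls"
    unfolding sorted_wrt_map_filter_iff unfolding sorted_wrt_iff_nth_less
  proof (intro allI impI)
    fix p q a b assume pq: "p < q" "q < length \<pi>" "g (\<pi> ! p) = Some a" "g (\<pi> ! q) = Some b"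
    then have ab: "a \<in> {1..k}" "b \<in> {1..k}" "\<pi> ! f a = \<pi> ! p" "\<pi> ! f b = \<pi> ! q"
      by (auto simp: g_iff)
    then have "f a = p" "f b = q"
      using pq len \<pi>(1) by (simp_all add: nth_eq_iff_index_eq)
    then show "a < b" using ab mono[of b a] pq(1) by (cases a b rule: linorder_cases) auto
  qed
  moreover have "set ?ls = {1..k}"
  proof (intro equalityI subsetI)
    fix a assume "a \<in> set ?ls"
    then obtain v where "g v = Some a" by auto
    then show "a \<in> {1..k}" by (simp add: g_iff)
  next
    fix a assume a: "a \<in> {1..k}"
    then have "g (\<pi> ! f a) = Some a" "\<pi> ! f a \<in> set \<pi>" using len by (auto simp: g_iff)
    then show "a \<in> set ?ls" by force
  qed
  ultimately have "?ls = [1..<Suc k]"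
    by (intro sorted_distinct_set_unique)
      (auto simp: strict_sorted_iff atLeastLessThanSuc_atLeastAtMost simp del: upt_Suc)
  then have proj: "project g (map Entry \<pi>) = map Entry [1..<Suc k]"
    unfolding project_map_Entry by simp
  have "count_list (map Entry [1..<Suc k]) Slot = 0"
    by (auto simp: count_list_0_iff)
  then have "map Entry [1..<Suc k] \<in> shapes k"
    by (auto simp: shapes_def simp del: upt_Suc)
  moreover have "dom g \<subseteq> {1..n}"
    using len \<pi>(2) nth_mem by (fastforce simp: g_iff dom_def)
  moreover have "down_closed P g"
    unfolding down_closed_def
  proof (intro allI impI)
    fix u a b assume A: "g u = Some b \<and> (a, b) \<in> P \<and> a \<noteq> b"
    then have "a \<in> {1..k}" using po by (auto simp: order_on_defs)
    with A less[of a b] show "\<exists>v<u. g v = Some a" by (auto simp: g_iff f_def)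
  qed
  ultimately show "map Entry [1..<Suc k] \<in> partial_embeddings k P n (map Entry \<pi>)"
    unfolding partial_embeddings_def proj[symmetric] by blast
qed

section \<open>The automaton for the avoiders\<close>

theorem theorem5:
  fixes k :: nat and P :: "nat rel"
  assumes "partial_order_on {1..k} P"
    and "bipartite_pop P"
  shows "has_regular_insertion_encoding (Av k P)"
proof -
  let ?\<Sigma> = "UNIV \<times> {1..Suc k} :: letter set"
  let ?run = "foldl (advance k P) {[Slot]}"
  \<comment> \<open>\<open>[]\<close> is the projection along the empty labelling of a configuration without slots.\<close>
  let ?F = "{S \<in> Pow (shapes k). [] \<in> S \<and> map Entry [1..<Suc k] \<notin> S}"
  have "encodings (Av k P) = {w \<in> lists ?\<Sigma>. ?run w \<in> ?F}"
  proof (intro equalityI subsetI)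
    fix w assume "w \<in> encodings (Av k P)"
    then obtain \<pi> where \<pi>: "\<not> contains_pop k P \<pi>" and w: "builds w (map Entry \<pi>)"
      by (auto simp: encodings_def Av_def encodes_def)
    have "count_list d Slot \<le> Suc k" if "w = u @ v" "builds u d" for u v d
      using count_Slot_le_if_avoids[OF assms that(2), of v \<pi>] that w \<pi> by simp
    then have run: "?run w = partial_embeddings k P (length w) (map Entry \<pi>)" "w \<in> lists ?\<Sigma>"
      using builds_imp_run[OF w, of k P] by auto
    have no_slot: "count_list (map Entry \<pi>) Slot = 0" by (auto simp: count_list_0_iff)
    have "[] \<in> ?run w"
      unfolding run partial_embeddings_def using no_slot
      by (auto simp: project_empty shapes_def down_closed_def intro!: exI[of _ Map.empty])
    moreover have "map Entry [1..<Suc k] \<notin> ?run w"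
      using full_embedding_iff_contains_pop[OF assms(1)] builds_entries[OF w] \<pi> run by simp
    moreover have "?run w \<subseteq> shapes k" unfolding run by (auto simp: partial_embeddings_def)
    ultimately show "w \<in> {w \<in> lists ?\<Sigma>. ?run w \<in> ?F}" using run(2) by blast
  next
    fix w assume "w \<in> {w \<in> lists ?\<Sigma>. ?run w \<in> ?F}"
    then have w: "[] \<in> ?run w" "map Entry [1..<Suc k] \<notin> ?run w" by auto
    then obtain c where c: "builds w c" "?run w = partial_embeddings k P (length w) c"
      using run_nonempty_imp_builds[of k P w] by blast
    \<comment> \<open>All members of a state have as many slots as \<open>c\<close>, and
      \<open>[]\<close> has none.\<close>
    have "count_list c Slot = 0" using partial_embeddings_slots w(1) c(2) by fastforce
    then have eq: "map Entry (entries c) = c" by (simp add: count_list_0_iff map_Entry_entries)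
    have perm: "distinct (entries c)" "set (entries c) = {1..length w}"
      using builds_entries[OF c(1)] by auto
    then have "\<not> contains_pop k P (entries c)"
      using full_embedding_iff_contains_pop[OF assms(1) perm] w(2) c(2) eq by simp
    then have "entries c \<in> Av k P"
      using perm unfolding Av_def by (blast intro: permutations_of_setI)
    moreover have "encodes w (entries c)" using c(1) eq by (simp add: encodes_def)
    ultimately show "w \<in> encodings (Av k P)" by (auto simp: encodings_def)
  qed
  moreover have "regular_language ?\<Sigma> {w \<in> lists ?\<Sigma>. ?run w \<in> ?F}"
  proof (rule regular_languageI)
    show "finite (Pow (shapes k))" by (simp add: finite_shapes)
    show "{[Slot]} \<in> Pow (shapes k)" by (simp add: shapes_def)
  qed (auto simp: advance_def)
  moreover have "finite ?\<Sigma>"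
  proof -
    have "(UNIV :: operation set) = {Fill, Leftmost, Rightmost, Middle}"
      using operation.exhaust by auto
    then have "finite (UNIV :: operation set)" by (metis finite.emptyI finite.insertI)
    then show ?thesis by simp
  qed
  ultimately show ?thesis unfolding has_regular_insertion_encoding_def by metis
qed

end
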